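(* Let $\mathcal{M}=(\mathcal{M}_i)_{i\in[M]}$ be a set of $M$ bandits with common action set $\mathcal{A}$ and reward distributions $R_i(a)$ such that ($\lambda$-separation) for any $\mathcal{M}_i,\mathcal{M}_j\in\mathcal{M}$ (with $i\ne j$) there exists $a\in\mathcal{A}$ with $\|R_i(a)-R_j(a)\|_1\ge\lambda$. For any $H\ge M-1$ and any $\mathcal{M}_i\in\mathcal{M}$, we have $$\mathcal{R}_H(\mathcal{M}_i,\hat\pi)=\mathcal{O}\left(\frac{M\log(MH)}{\lambda^4}\right),$$ where $\hat\pi$ is the sampling rule induced by the Identify-then-Commit algorithm for bandits (described in the context).
   Context: Setting. Each bandit $\mathcal{M}_i$ has the finite action set $\mathcal{A}=(a_j)_{j\in[A]}$; playing $a_j$ in $\mathcal{M}_i$ yields a reward drawn from the distribution $R_i(a_j)$, whose mean $\mu_{ij}$ is in $[0,1]$. $R_i(x|a)$ denotes the likelihood (density or mass) of reward $x$ under $R_i(a)$. The reward distributions of all bandits in $\mathcal{M}$ are fully known to the agent, who faces an unknown test bandit $\mathcal{M}_i\in\mathcal{M}$ for $H$ steps. The test-time regret is $\mathcal{R}_H(\mathcal{M}_i,\pi)=\mathbb{E}\big[\sum_{h=1}^H\mu^*-\mu_h\big]$, where $\mu^*$ is the mean reward of an optimal action of $\mathcal{M}_i$ and $\mu_h$ is the mean reward in $\mathcal{M}_i$ of the action $a_h$ played by $\pi$ at step $h$. $\|\cdot\|_1$ is the $\ell_1$-distance between distributions. Identify-then-Commit for bandits. Initialize $\mathcal{D}=\mathcal{M}$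 and $n=\frac{2\log(2MH)}{\lambda^4}$. While $|\mathcal{D}|>1$: draw $\mathcal{M}_1,\mathcal{M}_2$ from $\mathcal{D}$ randomly. Take $\tilde a\in\arg\max_{a\in\mathcal{A}}\|R_1(a)-R_2(a)\|_1$. Collect $n$ samples $\mathcal{X}=(x_1,\dots,x_n)$ by pulling $\tilde a$ in the test bandit. If $\prod_{x_h\in\mathcal{X}}\frac{R_1(x_h|\tilde a)}{R_2(x_h|\tilde a)}\ge1$, eliminate $\mathcal{M}_2$ from $\mathcal{D}$, otherwise eliminate $\mathcal{M}_1$. When the loop ends, take the remaining $\hat{\mathcal{M}}\in\mathcal{D}$ and pull the action $\hat a\in\arg\max_{a\in\mathcal{A}}\hat\mu(a)$ (optimal for $\hat{\mathcal{M}}$, whose mean rewards are $\hat\mu$) for the remaining steps. $\mathcal{O}(\cdot)$ hides absolute multiplicative constants.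
   Formalization: The number of samples per round is n = 2 log(2MH)/min(λ,1/2)^4, rounded up, instead of 2 log(2MH)/λ^4; with the original n the bound fails for larger λ, e.g. M = 2, λ = 1, Ber(1/4) against Ber(3/4) and a second action Ber(1/2) in both. *)

theory Defs
  imports "HOL-Probability.Probability" "HOL-Probability.Product_PMF"
begin

text \<open>
  A family of \<open>M\<close> bandits with \<open>K\<close> actions: bandits are indexed by \<open>i < M\<close>, actions by \<open>a < K\<close>.
  The likelihood \<open>p i a x\<close> is the density of the reward distribution with respect to a reference
  measure \<open>\<nu> a\<close> common to all bandits: Lebesgue measure gives densities, counting measure gives mass
  functions, and any finite family of distributions is dominated by some such measure.
\<close>

definition reward_dist ::
  "(nat \<Rightarrow> real measure) \<Rightarrow> (nat \<Rightarrow> nat \<Rightarrow> real \<Rightarrow> real) \<Rightarrow> nat \<Rightarrow> nat \<Rightarrow> real measure" where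
  "reward_dist \<nu> p i a = density (\<nu> a) (\<lambda>x. ennreal (p i a x))"

definition mean_reward :: "(nat \<Rightarrow> real measure) \<Rightarrow> nat \<Rightarrow> real" where
  "mean_reward B a = (\<integral>x. x \<partial>B a)"

definition bandit_family ::
  "nat \<Rightarrow> nat \<Rightarrow> (nat \<Rightarrow> real measure) \<Rightarrow> (nat \<Rightarrow> nat \<Rightarrow> real \<Rightarrow> real) \<Rightarrow> bool" where
  "bandit_family M K \<nu> p \<longleftrightarrow>
     K \<ge> 1 \<and>
     (\<forall>a<K. sets (\<nu> a) = sets borel) \<and>
     (\<forall>i<M. \<forall>a<K.
        p i a \<in> borel_measurable borel \<and> (\<forall>x. 0 \<le> p i a x) \<and>
        prob_space (reward_dist \<nu> p i a) \<and>
        integrable (reward_dist \<nu> p i a) (\<lambda>x. x) \<and>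
        mean_reward (reward_dist \<nu> p i) a \<in> {0..1})"

definition l1_dist ::
  "(nat \<Rightarrow> real measure) \<Rightarrow> (nat \<Rightarrow> nat \<Rightarrow> real \<Rightarrow> real) \<Rightarrow> nat \<Rightarrow> nat \<Rightarrow> nat \<Rightarrow> real" where
  "l1_dist \<nu> p i j a = (\<integral>x. \<bar>p i a x - p j a x\<bar> \<partial>\<nu> a)"

definition separated ::
  "nat \<Rightarrow> nat \<Rightarrow> (nat \<Rightarrow> real measure) \<Rightarrow> (nat \<Rightarrow> nat \<Rightarrow> real \<Rightarrow> real) \<Rightarrow> real \<Rightarrow> bool" where
  "separated M K \<nu> p lam \<longleftrightarrow>
     (\<forall>i<M. \<forall>j<M. i \<noteq> j \<longrightarrow> (\<exists>a<K. l1_dist \<nu> p i j a \<ge> lam))"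

text \<open>
  A randomized policy consists of the law of its internal randomness and, for every outcome of it,
  a map from the history of (action, reward) pairs to the next action.
\<close>

type_synonym 's policy = "'s pmf \<times> ('s \<Rightarrow> (nat \<times> real) list \<Rightarrow> nat)"

text \<open>
  The interaction uses a table \<open>x\<close> of independent rewards, where \<open>x (h, a)\<close>, with the law of the
  rewards of action \<open>a\<close>, is what the agent receives if it plays \<open>a\<close> at step \<open>h\<close>.
  Only the entries of the actions actually played are revealed.
\<close>

primrec history ::
  "((nat \<times> real) list \<Rightarrow> nat) \<Rightarrow> (nat \<times> nat \<Rightarrow> real) \<Rightarrow> nat \<Rightarrow> (nat \<times> real) list" where
  "history \<pi> x 0 = []"
| "history \<pi> x (Suc h) =
     (let hs = history \<pi> x h; a = \<pi> hs in hs @ [(a, x (h, a))])"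

definition test_regret :: "nat \<Rightarrow> nat \<Rightarrow> (nat \<Rightarrow> real measure) \<Rightarrow> 's policy \<Rightarrow> real" where
  "test_regret K H B pol =
     (\<integral>s. (\<integral>x. (\<Sum>h<H. Max (mean_reward B ` {..<K})
                       - mean_reward B (snd pol s (history (snd pol s) x h)))
            \<partial>PiM ({..<H} \<times> {..<K}) (\<lambda>(h, a). B a))
      \<partial>measure_pmf (fst pol))"

text \<open>
  Identify-then-Commit. The internal randomness \<open>u\<close> assigns to every candidate set \<open>D\<close> an independent
  uniformly drawn ordered pair of distinct elements of \<open>D\<close>. As the candidate set shrinks strictly in
  every round, no set is used twice, so this amounts to a fresh draw in each round.
\<close>

definition itc_draws :: "nat \<Rightarrow> (nat set \<Rightarrow> nat \<times> nat) pmf" where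
  "itc_draws M = Pi_pmf {D. D \<subseteq> {..<M} \<and> card D > 1} undefined
     (\<lambda>D. pmf_of_set {(i, j). i \<in> D \<and> j \<in> D \<and> i \<noteq> j})"

text \<open>
  Samples per round. This number suffices for logarithmic regret only if \<open>lam\<close> is at most about
  1/2, and is to be applied to \<open>min lam (1/2)\<close>. For \<open>lam = 1\<close> it is too small: take two bandits, a first
  action with rewards Bernoulli(1/4) in one and Bernoulli(3/4) in the other, and a second
  action with rewards Bernoulli(1/2) in both. The test then errs with probability about
  \<open>H powr (-0.29)\<close>, and the regret is about \<open>H powr 0.71\<close>, up to logarithmic factors.
  Bandits that are \<open>lam\<close>-separated with \<open>lam > 1/2\<close> are also 1/2-separated, and \<open>lam \<le> 2\<close> if there
  are at least two, so the replacement affects the number of samples by a bounded factor only.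
\<close>

definition itc_samples :: "nat \<Rightarrow> nat \<Rightarrow> real \<Rightarrow> nat" where
  "itc_samples M H lam = nat \<lceil>2 * ln (2 * real M * real H) / lam ^ 4\<rceil>"

text \<open>
  Likelihood ratios are extended nonnegative reals, because \<open>r / 0 = \<infinity>\<close> is needed for \<open>r > 0\<close>:
  a sample that is impossible under the second bandit speaks for the first one.
\<close>

definition likelihood_ratio ::
  "(nat \<Rightarrow> nat \<Rightarrow> real \<Rightarrow> real) \<Rightarrow> nat \<Rightarrow> nat \<Rightarrow> nat \<Rightarrow> real list \<Rightarrow> ennreal" where
  "likelihood_ratio p i j a xs = (\<Prod>x\<leftarrow>xs. ennreal (p i a x) / ennreal (p j a x))"

text \<open>
  The set of candidates after \<open>k\<close> rounds of \<open>n\<close> samples each; \<open>sel i j\<close> is the action used to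
  compare the bandits \<open>i\<close> and \<open>j\<close>. Once a single candidate is left the set no longer changes.
\<close>

primrec itc_candidates ::
  "nat \<Rightarrow> (nat \<Rightarrow> nat \<Rightarrow> real \<Rightarrow> real) \<Rightarrow> nat \<Rightarrow> (nat \<Rightarrow> nat \<Rightarrow> nat) \<Rightarrow>
   (nat set \<Rightarrow> nat \<times> nat) \<Rightarrow> (nat \<times> real) list \<Rightarrow> nat \<Rightarrow> nat set" where
  "itc_candidates M p n sel u hs 0 = {..<M}"
| "itc_candidates M p n sel u hs (Suc k) =
     (let D = itc_candidates M p n sel u hs k in
      if card D > 1 then
        let (i, j) = u D; xs = map snd (take n (drop (k * n) hs)) in
        D - {if likelihood_ratio p i j (sel i j) xs \<ge> 1 then j else i}
      else D)"

definition itc_action ::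
  "nat \<Rightarrow> (nat \<Rightarrow> nat \<Rightarrow> real \<Rightarrow> real) \<Rightarrow> nat \<Rightarrow> (nat \<Rightarrow> nat \<Rightarrow> nat) \<Rightarrow> (nat \<Rightarrow> nat) \<Rightarrow>
   (nat set \<Rightarrow> nat \<times> nat) \<Rightarrow> (nat \<times> real) list \<Rightarrow> nat" where
  "itc_action M p n sel opt u hs =
     (let D = itc_candidates M p n sel u hs (length hs div n) in
      if card D > 1 then let (i, j) = u D in sel i j else opt (the_elem D))"

definition identify_then_commit ::
  "nat \<Rightarrow> (nat \<Rightarrow> nat \<Rightarrow> real \<Rightarrow> real) \<Rightarrow> nat \<Rightarrow> (nat \<Rightarrow> nat \<Rightarrow> nat) \<Rightarrow> (nat \<Rightarrow> nat) \<Rightarrow>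
   (nat set \<Rightarrow> nat \<times> nat) policy" where
  "identify_then_commit M p n sel opt = (itc_draws M, itc_action M p n sel opt)"

text \<open>Arbitrary tie-breaking in the two maximizations of the algorithm.\<close>

definition itc_choices ::
  "nat \<Rightarrow> nat \<Rightarrow> (nat \<Rightarrow> real measure) \<Rightarrow> (nat \<Rightarrow> nat \<Rightarrow> real \<Rightarrow> real) \<Rightarrow>
   (nat \<Rightarrow> nat \<Rightarrow> nat) \<Rightarrow> (nat \<Rightarrow> nat) \<Rightarrow> bool" where
  "itc_choices M K \<nu> p sel opt \<longleftrightarrow>
     (\<forall>i<M. \<forall>j<M. i \<noteq> j \<longrightarrow> is_arg_max (l1_dist \<nu> p i j) (\<lambda>a. a < K) (sel i j)) \<and>
     (\<forall>i<M. is_arg_max (mean_reward (reward_dist \<nu> p i)) (\<lambda>a. a < K) (opt i))"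

end

theory Submission
  imports Defs
begin

text \<open>
  If the rewards come from bandit \<open>i\<close>, the square root of the likelihood ratio of another bandit
  against \<open>i\<close> has as its mean the Bhattacharyya coefficient, which is at most \<open>1 - lam\<^sup>2 / 8\<close> for the
  tested action. Markov's inequality for the product over one round bounds the probability that
  \<open>i\<close> is eliminated in that round by \<open>(1 - lam\<^sup>2 / 8) ^ n \<le> 1 / (2 * M * H)\<close>. There are \<open>M - 1\<close> rounds,
  so the tests cost at most \<open>(M - 1) * n\<close>, and a wrong commitment costs at most \<open>1 / 2\<close> in expectation.
\<close>

section \<open>Histories and candidate sets\<close>

lemma length_history [simp]: "length (history \<pi> x h) = h"
  by (induction h) (simp_all add: Let_def)

lemma take_history: "k \<le> h \<Longrightarrow> take k (history \<pi> x h) = history \<pi> x k"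
  by (induction h) (auto simp: Let_def le_Suc_eq)

lemma nth_history:
  assumes "j < h"
  shows "history \<pi> x h ! j = (\<pi> (history \<pi> x j), x (j, \<pi> (history \<pi> x j)))"
proof -
  have "history \<pi> x h ! j = take (Suc j) (history \<pi> x h) ! j"
    using assms by simp
  also have "take (Suc j) (history \<pi> x h) = history \<pi> x (Suc j)"
    using assms by (intro take_history) auto
  finally show ?thesis
    by (simp add: Let_def nth_append)
qed

lemma likelihood_ratio_map_upt:
  "likelihood_ratio p i j a (map f [l..<m]) =
     (\<Prod>h\<in>{l..<m}. ennreal (p i a (f h)) / ennreal (p j a (f h)))"
  unfolding likelihood_ratio_def
  using prod.distinct_set_conv_list[of "[l..<m]"
      "\<lambda>h. ennreal (p i a (f h)) / ennreal (p j a (f h))"]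
  by (simp add: comp_def)

text \<open>The draws are frozen: \<open>u\<close> is any function picking two distinct members of
  every candidate set with at least two elements. Bounds proved here are therefore uniform over the
  outcomes of \<open>itc_draws M\<close>.\<close>

locale itc_run =
  fixes M n :: nat and p :: "nat \<Rightarrow> nat \<Rightarrow> real \<Rightarrow> real" and sel :: "nat \<Rightarrow> nat \<Rightarrow> nat"
    and opt :: "nat \<Rightarrow> nat" and u :: "nat set \<Rightarrow> nat \<times> nat"
  assumes n_pos: "n > 0"
    and u_draw: "\<And>D. D \<subseteq> {..<M} \<Longrightarrow> card D > 1 \<Longrightarrow>
      fst (u D) \<in> D \<and> snd (u D) \<in> D \<and> fst (u D) \<noteq> snd (u D)"
begin

definition test_action :: "nat set \<Rightarrow> nat" where
  "test_action D = sel (fst (u D)) (snd (u D))"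

text \<open>Round \<open>k\<close> occupies the steps \<open>{k * n..<Suc k * n}\<close>, and one
  action is played throughout it. The outcome of the test can thus be read off a single column of
  the reward table.\<close>

definition loser :: "nat set \<Rightarrow> nat \<Rightarrow> (nat \<times> nat \<Rightarrow> real) \<Rightarrow> nat" where
  "loser D k x =
     (let a = test_action D in
      if (\<Prod>h\<in>{k * n..<Suc k * n}. ennreal (p (fst (u D)) a (x (h, a))) /
            ennreal (p (snd (u D)) a (x (h, a)))) \<ge> 1
      then snd (u D) else fst (u D))"

text \<open>The candidate sets as a function of the reward table instead of the history.\<close>

primrec cands :: "(nat \<times> nat \<Rightarrow> real) \<Rightarrow> nat \<Rightarrow> nat set" where
  "cands x 0 = {..<M}"
| "cands x (Suc k) =
     (if card (cands x k) > 1 then cands x k - {loser (cands x k) k x} else cands x k)"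

abbreviation act :: "(nat \<times> real) list \<Rightarrow> nat" where
  "act \<equiv> itc_action M p n sel opt u"

text \<open>In round \<open>k\<close> the agent keeps seeing the candidate set
  \<open>cands x k\<close>, so it keeps playing the same test action, and that block of the history
  is a column segment of the table. The length \<open>h\<close> is generalized because the induction
  hypothesis is applied to every prefix ending inside the block.\<close>

lemma itc_candidates_history:
  "k * n \<le> h \<Longrightarrow> itc_candidates M p n sel u (history act x h) k = cands x k"
proof (induction k arbitrary: h)
  case (Suc k)
  let ?D = "cands x k" and ?l = "k * n" and ?r = "Suc k * n"
  have IH: "itc_candidates M p n sel u (history act x j) k = ?D" if "?l \<le> j" for j
    using Suc.IH that by simp
  show ?case
  proof (cases "card ?D > 1")
    case True
    have act: "act (history act x j) = test_action ?D" if "?l \<le> j" "j < ?r" for j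
    proof -
      \<comment> \<open>The policy recomputes the number of completed rounds from the length of the
        history; it stays \<open>k\<close> throughout the block.\<close>
      have "j div n = k"
        using that n_pos by (intro div_nat_eqI) (auto simp: mult.commute)
      then show ?thesis
        using IH[OF that(1)] True
        by (simp add: itc_action_def[of _ _ _ _ _ _ "history _ _ _"] Let_def test_action_def
            case_prod_beta)
    qed
    have "map snd (take n (drop ?l (history act x h))) =
        map (\<lambda>j. x (j, test_action ?D)) [?l..<?r]"
      using Suc.prems by (intro nth_equalityI) (auto simp: nth_history act)
    then show ?thesis
      using IH[of h] Suc.prems True
      by (simp add: Let_def case_prod_beta likelihood_ratio_map_upt loser_def
            flip: test_action_def del: upt_Suc)
  next
    case False
    with IH[of h] Suc.prems show ?thesis
      by (simp add: Let_def)
  qed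
qed simp

lemma act_history:
  "act (history act x h) =
     (let D = cands x (h div n) in if card D > 1 then test_action D else opt (the_elem D))"
  by (simp add: itc_action_def[of _ _ _ _ _ _ "history _ _ _"] itc_candidates_history Let_def
      case_prod_beta test_action_def)

lemma cands_subset: "cands x k \<subseteq> {..<M}"
  by (induction k) auto

lemma loser_in: "D \<subseteq> {..<M} \<Longrightarrow> card D > 1 \<Longrightarrow> loser D k x \<in> D"
  using u_draw[of D] by (auto simp: loser_def Let_def)

text \<open>The loser is always a candidate, so every round removes exactly one element until one is
  left, which takes \<open>M - 1\<close> rounds.\<close>

lemma card_cands:
  assumes "M \<ge> 1"
  shows "card (cands x k) = max 1 (M - k)"
proof (induction k)
  case (Suc k)
  show ?case
  proof (cases "card (cands x k) > 1")
    case True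
    with loser_in[OF cands_subset True, of k x] Suc show ?thesis
      by (simp add: card_Diff_singleton)
  qed (use Suc in auto)
qed (use assms in simp)

lemma cands_stable: "M - 1 \<le> k \<Longrightarrow> cands x k = cands x (M - 1)" if "M \<ge> 1"
proof (induction k rule: dec_induct)
  case (step k)
  with card_cands[OF that, of x k] show ?case
    by simp
qed simp

text \<open>The candidate set of round \<open>k\<close> is determined by the rows before its block.
  This is what makes it independent of the rewards in that block.\<close>

lemma cands_cong:
  assumes "\<And>D. D \<subseteq> {..<M} \<Longrightarrow> card D > 1 \<Longrightarrow> test_action D < K"
    and "\<And>h a. h < k * n \<Longrightarrow> a < K \<Longrightarrow> x (h, a) = y (h, a)"
  shows "cands x k = cands y k"
  using assms(2)
proof (induction k)
  case (Suc k)
  then have IH: "cands x k = cands y k"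
    by simp
  show ?case
  proof (cases "card (cands y k) > 1")
    case True
    have "x (h, test_action (cands y k)) = y (h, test_action (cands y k))" if "h < Suc k * n" for h
      using Suc.prems[OF that] assms(1)[OF cands_subset True] by blast
    then have "loser (cands y k) k x = loser (cands y k) k y"
      by (simp add: loser_def Let_def)
    with IH show ?thesis
      by simp
  qed (use IH in simp)
qed simp

end

section \<open>The Hellinger bound\<close>

text \<open>Pointwise AM-GM for \<open>\<bar>p - q\<bar> = \<bar>sqrt p - sqrt q\<bar> * (sqrt p + sqrt q)\<close> with weight \<open>t = 4 / lam\<close>
  replaces the Cauchy-Schwarz inequality for integrals.\<close>

lemma bhattacharyya_le:
  fixes p q :: "'a \<Rightarrow> real"
  assumes p: "has_bochner_integral N p 1" "\<And>x. 0 \<le> p x"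
    and q: "has_bochner_integral N q 1" "\<And>x. 0 \<le> q x"
    and lam: "lam > 0" "(\<integral>x. \<bar>p x - q x\<bar> \<partial>N) \<ge> lam"
  shows "integrable N (\<lambda>x. sqrt (p x * q x))" "(\<integral>x. sqrt (p x * q x) \<partial>N) \<le> 1 - lam\<^sup>2 / 8"
proof -
  note [measurable] = borel_measurable_has_bochner_integral[OF p(1)]
    borel_measurable_has_bochner_integral[OF q(1)]
  have int: "integrable N p" "integrable N q" "integral\<^sup>L N p = 1" "integral\<^sup>L N q = 1"
    using p(1) q(1) by (auto simp: has_bochner_integral_iff)
  have AMGM: "sqrt (p x * q x) \<le> (p x + q x) / 2" for x
    using arith_geo_mean_sqrt p(2) q(2) by blast
  show bc: "integrable N (\<lambda>x. sqrt (p x * q x))"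
  proof (rule Bochner_Integration.integrable_bound)
    show "integrable N (\<lambda>x. (p x + q x) / 2)"
      using int by auto
    show "AE x in N. norm (sqrt (p x * q x)) \<le> norm ((p x + q x) / 2)"
      using AMGM p(2) q(2) by (auto intro!: AE_I2)
  qed measurable
  define B where "B = (\<integral>x. sqrt (p x * q x) \<partial>N)"
  have "B \<le> (\<integral>x. (p x + q x) / 2 \<partial>N)"
    unfolding B_def using bc int AMGM by (intro integral_mono) auto
  then have B1: "B \<le> 1"
    using int by simp
  define t where "t = 4 / lam"
  have t: "t > 0"
    using lam by (simp add: t_def)
  have "\<bar>p x - q x\<bar> \<le> t / 2 * (p x + q x - 2 * sqrt (p x * q x))
      + 1 / (2 * t) * (p x + q x + 2 * sqrt (p x * q x))" (is "_ \<le> ?R x") for x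
  proof -
    define a b where "a = sqrt (p x)" and "b = sqrt (q x)"
    have ab: "p x = a\<^sup>2" "q x = b\<^sup>2" "sqrt (p x * q x) = a * b" "a \<ge> 0" "b \<ge> 0"
      using p(2) q(2) by (simp_all add: a_def b_def real_sqrt_mult)
    define c d where "c = \<bar>a - b\<bar>" and "d = a + b"
    \<comment> \<open>Weighted AM-GM for \<open>c * d\<close>, by expanding a square.\<close>
    have "0 \<le> (t * c - d)\<^sup>2 / (2 * t)"
      using t by simp
    also have "\<dots> = t / 2 * c\<^sup>2 + 1 / (2 * t) * d\<^sup>2 - c * d"
      using t by (simp add: field_simps power2_eq_square)
    finally have "c * d \<le> t / 2 * c\<^sup>2 + 1 / (2 * t) * d\<^sup>2"
      by simp
    moreover have "\<bar>p x - q x\<bar> = c * d"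
      using ab(4,5) unfolding ab(1,2) c_def d_def
      by (simp add: power2_eq_square square_diff_square_factored abs_mult)
    moreover have "c\<^sup>2 = p x + q x - 2 * sqrt (p x * q x)"
      unfolding ab(3) unfolding ab(1,2) c_def by (simp add: power2_diff)
    moreover have "d\<^sup>2 = p x + q x + 2 * sqrt (p x * q x)"
      unfolding ab(3) unfolding ab(1,2) d_def by (simp add: power2_sum)
    ultimately show ?thesis
      by simp
  qed
  then have "(\<integral>x. \<bar>p x - q x\<bar> \<partial>N) \<le> (\<integral>x. ?R x \<partial>N)"
    using bc int by (intro integral_mono) auto
  also have "\<dots> = t / 2 * (2 - 2 * B) + 1 / (2 * t) * (2 + 2 * B)"
    using bc int unfolding B_def by simp
  \<comment> \<open>Since \<open>B <= 1\<close>, the second term is at most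
    \<open>2 / t = lam / 2\<close>. The choice of \<open>t\<close> makes this half of the lower
    bound \<open>lam\<close>, so the other half must come from \<open>1 - B\<close>.\<close>
  also have "\<dots> \<le> t / 2 * (2 - 2 * B) + 1 / (2 * t) * 4"
    using B1 t by (intro add_left_mono mult_left_mono) auto
  also have "\<dots> = 4 / lam * (1 - B) + lam / 2"
    using lam by (simp add: t_def field_simps)
  finally have "lam / 2 \<le> 4 / lam * (1 - B)"
    using lam(2) by linarith
  then show "(\<integral>x. sqrt (p x * q x) \<partial>N) \<le> 1 - lam\<^sup>2 / 8"
    using lam by (simp add: B_def field_simps power2_eq_square)
qed

lemma sqrt_prod: "sqrt (\<Prod>h\<in>A. f h) = (\<Prod>h\<in>A. sqrt (f h))"
  by (induction A rule: infinite_finite_induct) (auto simp: real_sqrt_mult)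

text \<open>\<open>P\<close> is the likelihood under the true bandit and \<open>Q\<close> that under
  its opponent; this is the test with the true bandit in first position. A ratio below 1 has an
  inverse above 1, and so has its root.\<close>

lemma prod_sqrt_ge_1_if_ratio_less_1:
  fixes P Q :: "'a \<Rightarrow> real"
  assumes "finite A" "\<And>h. h \<in> A \<Longrightarrow> P h > 0" "\<And>h. h \<in> A \<Longrightarrow> Q h \<ge> 0"
    and less: "(\<Prod>h\<in>A. ennreal (P h) / ennreal (Q h)) < 1"
  shows "(\<Prod>h\<in>A. ennreal (sqrt (Q h / P h))) \<ge> 1"
proof -
  \<comment> \<open>A zero of \<open>Q\<close> would contribute an infinite factor. All other
    factors are nonzero because \<open>P\<close> is positive, so the product would be infinite
    rather than below 1.\<close>
  have Q: "Q h > 0" if "h \<in> A" for h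
  proof (rule ccontr)
    assume "\<not> Q h > 0"
    with assms(3)[OF that] have "Q h = 0"
      by simp
    with assms(2)[OF that] have "ennreal (P h) / ennreal (Q h) = \<top>"
      by (simp add: ennreal_divide_zero)
    moreover have "ennreal (P j) / ennreal (Q j) \<noteq> 0" if "j \<in> A" for j
      using assms(2)[OF that] by (auto simp: ennreal_divide_eq_0_iff)
    ultimately have "(\<Prod>h\<in>A. ennreal (P h) / ennreal (Q h)) = \<top>"
      using assms(1) that by (simp add: prod.remove[of _ h] ennreal_top_mult)
    with less show False
      by simp
  qed
  have "(\<Prod>h\<in>A. ennreal (P h) / ennreal (Q h)) = ennreal (\<Prod>h\<in>A. P h / Q h)"
    using assms(2) Q by (subst prod_ennreal[symmetric]) (auto simp: divide_ennreal less_imp_le intro!: prod.cong)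
  with less have "(\<Prod>h\<in>A. P h / Q h) < 1"
    by (simp add: ennreal_less_one_iff)
  moreover have "(\<Prod>h\<in>A. P h / Q h) > 0"
    using assms(2) Q by (intro prod_pos) auto
  ultimately have "1 \<le> inverse (\<Prod>h\<in>A. P h / Q h)"
    by (simp add: one_le_inverse)
  also have "\<dots> = (\<Prod>h\<in>A. Q h / P h)"
    by (simp add: prod_dividef)
  finally have "1 \<le> (\<Prod>h\<in>A. Q h / P h)" .
  then have "1 \<le> sqrt (\<Prod>h\<in>A. Q h / P h)"
    by simp
  also have "\<dots> = (\<Prod>h\<in>A. sqrt (Q h / P h))"
    by (rule sqrt_prod)
  finally show ?thesis
    using assms(2,3) by (subst prod_ennreal) (auto simp: less_imp_le)
qed

text \<open>The mirror case, with the true bandit in second position. The denominators are positive,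
  so all factors are finite.\<close>

lemma prod_sqrt_ge_1_if_ratio_ge_1:
  fixes P Q :: "'a \<Rightarrow> real"
  assumes "finite A" "\<And>h. h \<in> A \<Longrightarrow> P h > 0" "\<And>h. h \<in> A \<Longrightarrow> Q h \<ge> 0"
    and ge: "(\<Prod>h\<in>A. ennreal (Q h) / ennreal (P h)) \<ge> 1"
  shows "(\<Prod>h\<in>A. ennreal (sqrt (Q h / P h))) \<ge> 1"
proof -
  have "(\<Prod>h\<in>A. ennreal (Q h) / ennreal (P h)) = ennreal (\<Prod>h\<in>A. Q h / P h)"
    using assms(2,3) by (subst prod_ennreal[symmetric]) (auto simp: divide_ennreal less_imp_le intro!: prod.cong)
  with ge have "1 \<le> sqrt (\<Prod>h\<in>A. Q h / P h)"
    by (simp add: ennreal_ge_1)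
  also have "\<dots> = (\<Prod>h\<in>A. sqrt (Q h / P h))"
    by (rule sqrt_prod)
  finally show ?thesis
    using assms(2,3) by (subst prod_ennreal) (auto simp: less_imp_le)
qed

section \<open>Regret for a fixed sequence of draws\<close>

lemma bandit_family_integral:
  assumes "bandit_family M K \<nu> p" "j < M" "a < K"
  shows "has_bochner_integral (\<nu> a) (p j a) 1"
proof -
  have [measurable_cong]: "sets (\<nu> a) = sets borel" and [measurable]: "p j a \<in> borel_measurable borel"
    and nonneg: "\<And>x. 0 \<le> p j a x"
    using assms by (auto simp: bandit_family_def)
  interpret prob_space "reward_dist \<nu> p j a"
    using assms by (auto simp: bandit_family_def)
  have "emeasure (reward_dist \<nu> p j a) (space (\<nu> a)) = 1"
    using emeasure_space_1 by (simp add: reward_dist_def)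
  then have "(\<integral>\<^sup>+x. ennreal (p j a x) * indicator (space (\<nu> a)) x \<partial>\<nu> a) = 1"
    unfolding reward_dist_def by (subst (asm) emeasure_density) auto
  moreover have "(\<integral>\<^sup>+x. ennreal (p j a x) * indicator (space (\<nu> a)) x \<partial>\<nu> a) =
      (\<integral>\<^sup>+x. ennreal (p j a x) \<partial>\<nu> a)"
    by (intro nn_integral_cong) simp
  ultimately show ?thesis
    by (intro has_bochner_integral_nn_integral) (auto simp: nonneg)
qed

text \<open>Integrate \<open>\<bar>p - q\<bar> \<le> p + q\<close>. With two separated bandits this
  gives \<open>lam <= 2\<close>, which makes the truncated separation comparable to
  \<open>lam\<close>.\<close>

lemma l1_dist_le_2:
  assumes "bandit_family M K \<nu> p" "i < M" "j < M" "a < K"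
  shows "l1_dist \<nu> p i j a \<le> 2"
proof -
  note int = bandit_family_integral[OF assms(1,2,4)] bandit_family_integral[OF assms(1,3,4)]
  have nonneg: "0 \<le> p i a x" "0 \<le> p j a x" for x
    using assms by (auto simp: bandit_family_def)
  have "l1_dist \<nu> p i j a \<le> (\<integral>x. p i a x + p j a x \<partial>\<nu> a)"
    unfolding l1_dist_def
  proof (rule integral_mono')
    show "\<bar>p i a x - p j a x\<bar> \<le> p i a x + p j a x" "0 \<le> p i a x + p j a x" for x
      using nonneg[of x] by auto
  qed (use int in \<open>auto simp: has_bochner_integral_iff\<close>)
  also have "\<dots> = 2"
    using int by (simp add: has_bochner_integral_iff)
  finally show ?thesis .
qed

text \<open>Bandit \<open>i\<close> is the test bandit, and \<open>lam\<close> stands for the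
  truncated separation; \<open>lam <= 1\<close> keeps \<open>1 - lam\<^sup>2 / 8\<close>
  nonnegative.\<close>

locale itc_bandit = itc_run M n p sel opt u
  for M n :: nat and p :: "nat \<Rightarrow> nat \<Rightarrow> real \<Rightarrow> real" and sel :: "nat \<Rightarrow> nat \<Rightarrow> nat"
    and opt :: "nat \<Rightarrow> nat" and u :: "nat set \<Rightarrow> nat \<times> nat" +
  fixes K H i :: nat and \<nu> :: "nat \<Rightarrow> real measure" and lam :: real
  assumes family: "bandit_family M K \<nu> p"
    and lam: "lam > 0" "lam \<le> 1"
    and separated: "separated M K \<nu> p lam"
    and choices: "itc_choices M K \<nu> p sel opt"
    and i_less: "i < M"
begin

text \<open>Actions outside the range get a dummy law, so that all coordinates of the table are
  probability spaces.\<close>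

definition law :: "nat \<times> nat \<Rightarrow> real measure" where
  "law = (\<lambda>(h, a). if a < K then reward_dist \<nu> p i a else return borel 0)"

definition table :: "(nat \<times> nat \<Rightarrow> real) measure" where
  "table = PiM ({..<H} \<times> {..<K}) law"

text \<open>Meaningful when \<open>i\<close> belongs to the drawn pair; for other pairs it is merely
  the first member.\<close>

definition opponent :: "nat set \<Rightarrow> nat" where
  "opponent D = (if fst (u D) = i then snd (u D) else fst (u D))"

text \<open>Where the likelihood under \<open>i\<close> vanishes, division by zero gives the value
  0; under the law of \<open>i\<close> this concerns a null set only.\<close>

definition root_ratio :: "nat set \<Rightarrow> real \<Rightarrow> ennreal" where
  "root_ratio D x = ennreal (sqrt (p (opponent D) (test_action D) x / p i (test_action D) x))"

definition tested :: "nat set \<Rightarrow> bool" where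
  "tested D \<longleftrightarrow> card D > 1 \<and> i \<in> {fst (u D), snd (u D)}"

text \<open>Almost surely at least 1 whenever bandit \<open>i\<close> is eliminated from \<open>D\<close> in round \<open>k\<close>, so that its
  mean bounds the probability of this event.\<close>

definition evidence :: "nat \<Rightarrow> nat set \<Rightarrow> (nat \<times> nat \<Rightarrow> real) \<Rightarrow> ennreal" where
  "evidence k D x =
     (if tested D then \<Prod>h\<in>{k * n..<Suc k * n}. root_ratio D (x (h, test_action D)) else 0)"

section \<open>The reward table and the mean of one root ratio\<close>

lemma sets_law [simp, measurable_cong]: "a < K \<Longrightarrow> sets (reward_dist \<nu> p i a) = sets borel"
  "sets (law ha) = sets borel"
  using family by (auto simp: law_def reward_dist_def bandit_family_def split: prod.split)

lemma p_measurable [measurable]: "j < M \<Longrightarrow> a < K \<Longrightarrow> p j a \<in> borel_measurable borel"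
  using family by (auto simp: bandit_family_def)

lemma p_nonneg: "j < M \<Longrightarrow> a < K \<Longrightarrow> 0 \<le> p j a x"
  using family by (auto simp: bandit_family_def)

lemma sets_\<nu>: "a < K \<Longrightarrow> sets (\<nu> a) = sets borel"
  using family by (auto simp: bandit_family_def)

lemma prob_space_law: "prob_space (law ha)"
  using family i_less
  by (auto simp: law_def bandit_family_def prob_space_return split: prod.split)

sublocale law: product_prob_space law UNIV
  using prob_space_law
  by (simp add: product_prob_space_def product_prob_space_axioms_def product_sigma_finite_def
      prob_space_imp_sigma_finite)

sublocale table: prob_space table
  unfolding table_def by (rule prob_space_PiM) (rule prob_space_law)

lemma table_eq: "table = PiM ({..<H} \<times> {..<K}) (\<lambda>(h, a). reward_dist \<nu> p i a)"
  unfolding table_def by (rule PiM_cong) (auto simp: law_def)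

lemma component_measurable:
  assumes "ha \<in> J"
  shows "(\<lambda>x. x ha) \<in> borel_measurable (PiM J law)"
proof -
  have "(\<lambda>x. x ha) \<in> measurable (PiM J law) (law ha)"
    using assms by (rule measurable_component_singleton)
  then show ?thesis
    by (simp cong: measurable_cong_sets)
qed

text \<open>Some action separates the drawn pair by \<open>lam\<close>, and the test action
  maximizes the distance for that pair.\<close>

lemma test_action_less: "D \<subseteq> {..<M} \<Longrightarrow> card D > 1 \<Longrightarrow> test_action D < K"
  and l1_dist_test_action: "D \<subseteq> {..<M} \<Longrightarrow> card D > 1 \<Longrightarrow>
    l1_dist \<nu> p (fst (u D)) (snd (u D)) (test_action D) \<ge> lam"
proof -
  assume D: "D \<subseteq> {..<M}" "card D > 1"
  with u_draw[OF this] have "fst (u D) < M" "snd (u D) < M" "fst (u D) \<noteq> snd (u D)"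
    by auto
  with choices separated
  have "is_arg_max (l1_dist \<nu> p (fst (u D)) (snd (u D))) (\<lambda>a. a < K) (test_action D)"
    "\<exists>a<K. l1_dist \<nu> p (fst (u D)) (snd (u D)) a \<ge> lam"
    by (auto simp: itc_choices_def test_action_def separated_def)
  then show "test_action D < K" "l1_dist \<nu> p (fst (u D)) (snd (u D)) (test_action D) \<ge> lam"
    by (auto simp: is_arg_max_linorder intro: order.trans)
qed

lemma opponent_less: "D \<subseteq> {..<M} \<Longrightarrow> card D > 1 \<Longrightarrow> opponent D < M"
  using u_draw[of D] by (auto simp: opponent_def)

lemma root_ratio_measurable [measurable]:
  assumes "D \<subseteq> {..<M}" "card D > 1"
  shows "root_ratio D \<in> borel_measurable borel"
proof -
  note [measurable] = p_measurable[OF opponent_less[OF assms] test_action_less[OF assms]]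
    p_measurable[OF i_less test_action_less[OF assms]]
  show ?thesis
    unfolding root_ratio_def[abs_def] by measurable
qed

text \<open>Weighting the root of \<open>q / p\<close> by the density \<open>p\<close> of bandit
  \<open>i\<close> gives the root of \<open>p * q\<close>, so the mean is the Bhattacharyya
  coefficient.\<close>

lemma nn_integral_root_ratio:
  assumes D: "D \<subseteq> {..<M}" "tested D"
  shows "(\<integral>\<^sup>+x. root_ratio D x \<partial>law (h, test_action D)) \<le> ennreal (1 - lam\<^sup>2 / 8)"
proof -
  have card: "card D > 1"
    using D by (simp add: tested_def)
  define a q where "a = test_action D" and "q = p (opponent D) a"
  have a: "a < K" and q: "opponent D < M"
    unfolding a_def using D(1) card by (intro test_action_less opponent_less; simp)+
  note [measurable_cong] = sets_\<nu>[OF a]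
  note [measurable] = p_measurable[OF i_less a] p_measurable[OF q a, folded q_def]
    root_ratio_measurable[OF D(1) card]
  \<comment> \<open>The opponent may be either member of the pair; symmetry of the distance covers
    both orders.\<close>
  have "l1_dist \<nu> p i (opponent D) a \<ge> lam"
    using l1_dist_test_action[OF D(1) card] D(2)
    by (auto simp: tested_def opponent_def a_def l1_dist_def abs_minus_commute split: if_splits)
  then have l1: "(\<integral>x. \<bar>p i a x - q x\<bar> \<partial>\<nu> a) \<ge> lam"
    by (simp add: l1_dist_def q_def)
  note BC = bhattacharyya_le[OF bandit_family_integral[OF family i_less a] p_nonneg[OF i_less a]
      bandit_family_integral[OF family q a, folded q_def] p_nonneg[OF q a, folded q_def] lam(1) l1]
  have nn: "0 \<le> p i a x" "0 \<le> q x" for x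
    using p_nonneg i_less a q by (auto simp: q_def)
  have "(\<integral>\<^sup>+x. root_ratio D x \<partial>law (h, test_action D)) =
      (\<integral>\<^sup>+x. ennreal (p i a x) * root_ratio D x \<partial>\<nu> a)"
    using a unfolding law_def a_def[symmetric] reward_dist_def
    by (simp add: nn_integral_density)
  also have "\<dots> = (\<integral>\<^sup>+x. ennreal (sqrt (p i a x * q x)) \<partial>\<nu> a)"
  proof (intro nn_integral_cong)
    fix x
    have "p i a x * sqrt (q x / p i a x) = sqrt (p i a x * q x)"
    proof (cases "p i a x = 0")
      case False
      have "p i a x * sqrt (q x / p i a x) = sqrt ((p i a x)\<^sup>2 * (q x / p i a x))"
        using nn by (simp add: real_sqrt_mult del: times_divide_eq_right)
      also have "(p i a x)\<^sup>2 * (q x / p i a x) = p i a x * q x"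
        using False by (simp add: power2_eq_square)
      finally show ?thesis .
    qed simp
    then show "ennreal (p i a x) * root_ratio D x = ennreal (sqrt (p i a x * q x))"
      using nn by (simp add: root_ratio_def a_def[symmetric] q_def[symmetric] ennreal_mult'[symmetric])
  qed
  also have "\<dots> = ennreal (\<integral>x. sqrt (p i a x * q x) \<partial>\<nu> a)"
    using BC(1) nn by (intro nn_integral_eq_integral) auto
  also have "\<dots> \<le> ennreal (1 - lam\<^sup>2 / 8)"
    using BC(2) by (rule ennreal_leI)
  finally show "(\<integral>\<^sup>+x. root_ratio D x \<partial>law (h, test_action D)) \<le> ennreal (1 - lam\<^sup>2 / 8)" .
qed

section \<open>Measurability of the elimination process\<close>

lemma loser_measurable:
  assumes D: "D \<subseteq> {..<M}" "card D > 1" and J: "{k * n..<Suc k * n} \<times> {..<K} \<subseteq> J"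
  shows "(\<lambda>x. loser D k x) \<in> measurable (PiM J law) (count_space UNIV)"
proof -
  have *: "fst (u D) < M" "snd (u D) < M"
    using u_draw[OF D] D(1) by auto
  note [measurable] = p_measurable[OF *(1) test_action_less[OF D]]
    p_measurable[OF *(2) test_action_less[OF D]]
  have [measurable]: "(\<lambda>x. x (h, test_action D)) \<in> borel_measurable (PiM J law)"
    if "h \<in> {k * n..<Suc k * n}" for h
    using that J test_action_less[OF D] by (intro component_measurable) auto
  show ?thesis
    unfolding loser_def Let_def by measurable
qed

text \<open>The candidate set takes finitely many values, so it suffices to treat one update for
  each fixed set \<open>D\<close> and to compose.\<close>

lemma cands_measurable:
  assumes "{..<k * n} \<times> {..<K} \<subseteq> J"
  shows "(\<lambda>x. cands x k) \<in> measurable (PiM J law) (count_space (Pow {..<M}))"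
  using assms
proof (induction k)
  case 0
  then show ?case
    by simp
next
  case (Suc k)
  have IH: "(\<lambda>x. cands x k) \<in> measurable (PiM J law) (count_space (Pow {..<M}))"
    using Suc.prems by (intro Suc.IH) auto
  have "(\<lambda>x. (\<lambda>D x. if card D > 1 then D - {loser D k x} else D) (cands x k) x)
      \<in> measurable (PiM J law) (count_space (Pow {..<M}))"
  proof (rule measurable_compose_countable'[OF _ IH])
    fix D assume D: "D \<in> Pow {..<M}"
    show "(\<lambda>x. if card D > 1 then D - {loser D k x} else D)
        \<in> measurable (PiM J law) (count_space (Pow {..<M}))"
    proof (cases "card D > 1")
      case True
      have "(\<lambda>x. loser D k x) \<in> measurable (PiM J law) (count_space UNIV)"
        using D True Suc.prems by (intro loser_measurable) auto
      then have "(\<lambda>x. D - {loser D k x}) \<in> measurable (PiM J law) (count_space (Pow {..<M}))"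
        by (rule measurable_compose) (use D in auto)
      with True show ?thesis
        by simp
    qed (use D in simp)
  qed (simp add: countable_finite)
  then show ?case
    by simp
qed

lemma evidence_measurable:
  assumes "D \<subseteq> {..<M}" "{k * n..<Suc k * n} \<times> {..<K} \<subseteq> J"
  shows "evidence k D \<in> borel_measurable (PiM J law)"
proof (cases "tested D")
  case True
  then have card: "card D > 1"
    by (simp add: tested_def)
  note [measurable] = root_ratio_measurable[OF assms(1) card]
  have [measurable]: "(\<lambda>x. x (h, test_action D)) \<in> borel_measurable (PiM J law)"
    if "h \<in> {k * n..<Suc k * n}" for h
    using that assms test_action_less[OF assms(1) card] by (intro component_measurable) auto
  show ?thesis
    unfolding evidence_def[abs_def] by measurable
qed (simp add: evidence_def[abs_def])

lemma evidence_cands_measurable: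
  assumes "{..<Suc k * n} \<times> {..<K} \<subseteq> J"
  shows "(\<lambda>x. evidence k (cands x k) x) \<in> borel_measurable (PiM J law)"
proof (rule measurable_compose_countable'[where f = "evidence k"])
  show "(\<lambda>x. cands x k) \<in> measurable (PiM J law) (count_space (Pow {..<M}))"
    using assms by (intro cands_measurable) auto
  show "evidence k D \<in> borel_measurable (PiM J law)" if "D \<in> Pow {..<M}" for D
    using that assms by (intro evidence_measurable) auto
qed (simp add: countable_finite)

section \<open>Probability of eliminating the test bandit\<close>

lemma nn_integral_evidence_block:
  assumes D: "D \<subseteq> {..<M}"
  shows "(\<integral>\<^sup>+y. evidence k D y \<partial>PiM ({k * n..<Suc k * n} \<times> {..<K}) law)
    \<le> ennreal (1 - lam\<^sup>2 / 8) ^ n"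
proof (cases "tested D")
  case True
  then have card: "card D > 1"
    by (simp add: tested_def)
  define a R where "a = test_action D" and "R = {k * n..<Suc k * n}"
  have a: "a < K"
    unfolding a_def by (rule test_action_less[OF D card])
  \<comment> \<open>The factor 1 in the columns of unplayed actions extends the product to the whole
    rectangle, where the integral factorizes by independence. These columns integrate to 1, and each
    of the \<open>n\<close> played entries contributes at most
    \<open>1 - lam\<^sup>2 / 8\<close>.\<close>
  define f where "f = (\<lambda>(h::nat, c) y. if c = a then root_ratio D y else 1)"
  note [measurable] = root_ratio_measurable[OF D card]
  have f: "f hc \<in> borel_measurable (law hc)" for hc
    by (cases hc) (simp add: f_def)
  have "(\<integral>\<^sup>+y. evidence k D y \<partial>PiM (R \<times> {..<K}) law) =
      (\<integral>\<^sup>+y. (\<Prod>hc\<in>R \<times> {..<K}. f hc (y hc)) \<partial>PiM (R \<times> {..<K}) law)"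
  proof (intro nn_integral_cong)
    fix y :: "nat \<times> nat \<Rightarrow> real"
    have "(\<Prod>hc\<in>R \<times> {..<K}. f hc (y hc)) = (\<Prod>h\<in>R. \<Prod>c<K. f (h, c) (y (h, c)))"
      by (simp add: prod.cartesian_product)
    also have "\<dots> = evidence k D y"
      using a True by (simp add: f_def evidence_def R_def a_def)
    finally show "evidence k D y = (\<Prod>hc\<in>R \<times> {..<K}. f hc (y hc))"
      by simp
  qed
  also have "\<dots> = (\<Prod>hc\<in>R \<times> {..<K}. \<integral>\<^sup>+y. f hc y \<partial>law hc)"
    using f by (intro law.product_nn_integral_prod) (auto simp: R_def)
  also have "\<dots> = (\<Prod>h\<in>R. \<Prod>c<K. \<integral>\<^sup>+y. f (h, c) y \<partial>law (h, c))"
    by (simp add: prod.cartesian_product)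
  also have "\<dots> \<le> (\<Prod>h\<in>R. ennreal (1 - lam\<^sup>2 / 8))"
  proof (intro prod_mono_ennreal)
    fix h
    have "(\<integral>\<^sup>+y. f (h, c) y \<partial>law (h, c)) =
        (if c = a then \<integral>\<^sup>+y. root_ratio D y \<partial>law (h, a) else 1)" for c
      using prob_space.emeasure_space_1[OF prob_space_law] by (simp add: f_def)
    then show "(\<Prod>c<K. \<integral>\<^sup>+y. f (h, c) y \<partial>law (h, c)) \<le> ennreal (1 - lam\<^sup>2 / 8)"
      using a nn_integral_root_ratio[OF D True] by (simp add: a_def)
  qed
  also have "\<dots> = ennreal (1 - lam\<^sup>2 / 8) ^ n"
    by (simp add: R_def)
  finally show ?thesis
    by (simp add: R_def)
qed (simp add: evidence_def)

text \<open>The candidate set of round \<open>k\<close> depends on the rows of the table before the block of that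
  round, so given these rows the block is still a fresh i.i.d. sample.\<close>

lemma nn_integral_evidence:
  assumes "Suc k * n \<le> H"
  shows "(\<integral>\<^sup>+x. evidence k (cands x k) x \<partial>table) \<le> ennreal (1 - lam\<^sup>2 / 8) ^ n"
proof -
  define J where "J = {k * n..<Suc k * n} \<times> {..<K}"
  \<comment> \<open>All entries outside the block, later rows included; \<open>cands\<close> in
    round \<open>k\<close> reads only the earlier ones.\<close>
  define I where "I = {..<H} \<times> {..<K} - J"
  have J: "J \<subseteq> {..<H} \<times> {..<K}" and I: "{..<k * n} \<times> {..<K} \<subseteq> I"
    using assms by (auto simp: J_def I_def)
  have IJ: "I \<union> J = {..<H} \<times> {..<K}" "I \<inter> J = {}" "finite I" "finite J"
    using J by (auto simp: I_def J_def)
  have meas: "(\<lambda>x. evidence k (cands x k) x) \<in> borel_measurable (PiM (I \<union> J) law)"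
    using assms IJ by (intro evidence_cands_measurable) auto
  interpret I: prob_space "PiM I law"
    by (rule prob_space_PiM) (rule prob_space_law)
  have "(\<integral>\<^sup>+x. evidence k (cands x k) x \<partial>table) =
      (\<integral>\<^sup>+x. \<integral>\<^sup>+y. evidence k (cands (merge I J (x, y)) k) (merge I J (x, y))
        \<partial>PiM J law \<partial>PiM I law)"
    unfolding table_def IJ(1)[symmetric] using IJ meas by (intro law.product_nn_integral_fold)
  also have "\<dots> = (\<integral>\<^sup>+x. \<integral>\<^sup>+y. evidence k (cands x k) y \<partial>PiM J law \<partial>PiM I law)"
  proof (rule nn_integral_cong, rule nn_integral_cong)
    fix x y :: "nat \<times> nat \<Rightarrow> real"
    have "cands (merge I J (x, y)) k = cands x k"
      using I by (intro cands_cong[where K = K] test_action_less) (auto simp: merge_def)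
    moreover have "evidence k D (merge I J (x, y)) = evidence k D y" if "D \<subseteq> {..<M}" for D
    proof (cases "tested D")
      case True
      then have "test_action D < K"
        using that by (intro test_action_less) (auto simp: tested_def)
      then have "merge I J (x, y) (h, test_action D) = y (h, test_action D)"
        if "h \<in> {k * n..<Suc k * n}" for h
        using that by (auto simp: merge_def I_def J_def)
      then show ?thesis
        by (simp add: evidence_def)
    qed (simp add: evidence_def)
    ultimately show "evidence k (cands (merge I J (x, y)) k) (merge I J (x, y)) =
        evidence k (cands x k) y"
      using cands_subset by simp
  qed
  also have "\<dots> \<le> (\<integral>\<^sup>+x. ennreal (1 - lam\<^sup>2 / 8) ^ n \<partial>PiM I law)"
    unfolding J_def using cands_subset by (intro nn_integral_mono nn_integral_evidence_block)
  also have "\<dots> = ennreal (1 - lam\<^sup>2 / 8) ^ n"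
    using I.emeasure_space_1 by simp
  finally show ?thesis .
qed

text \<open>A candidate removed in round \<open>k\<close> is the loser, hence a member of the drawn
  pair. The cases reflect the asymmetry of the test: the first member loses on a ratio below 1, the
  second on a ratio of at least 1, ties included.\<close>

lemma evidence_ge_1:
  assumes i: "i \<in> cands x k" "i \<notin> cands x (Suc k)"
    and pos: "\<And>h a. h < Suc k * n \<Longrightarrow> a < K \<Longrightarrow> p i a (x (h, a)) > 0"
  shows "evidence k (cands x k) x \<ge> 1"
proof -
  define D a where "D = cands x k" and "a = test_action D"
  have D: "D \<subseteq> {..<M}" "card D > 1" "loser D k x = i"
    using i cands_subset by (auto simp: D_def split: if_splits)
  have a: "a < K" and q: "opponent D < M"
    unfolding a_def using D by (intro test_action_less opponent_less; simp)+
  have tested: "tested D"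
    using D(2,3) by (auto simp: tested_def loser_def Let_def split: if_splits)
  have "(\<Prod>h\<in>{k * n..<Suc k * n}.
      ennreal (sqrt (p (opponent D) a (x (h, a)) / p i a (x (h, a))))) \<ge> 1"
  proof (cases "fst (u D) = i")
    case True
    with D u_draw[of D] have "(\<Prod>h\<in>{k * n..<Suc k * n}.
        ennreal (p i a (x (h, a))) / ennreal (p (opponent D) a (x (h, a)))) < 1"
      by (auto simp: loser_def Let_def a_def opponent_def split: if_splits)
    then show ?thesis
      using a q pos p_nonneg by (intro prod_sqrt_ge_1_if_ratio_less_1) auto
  next
    case False
    with D have "snd (u D) = i" "(\<Prod>h\<in>{k * n..<Suc k * n}.
        ennreal (p (opponent D) a (x (h, a))) / ennreal (p i a (x (h, a)))) \<ge> 1"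
      by (auto simp: loser_def Let_def a_def opponent_def split: if_splits)
    then show ?thesis
      using a q pos p_nonneg by (intro prod_sqrt_ge_1_if_ratio_ge_1) auto
  qed
  with tested show ?thesis
    by (simp add: evidence_def root_ratio_def D_def[symmetric] a_def[symmetric])
qed

text \<open>Under its own law a density vanishes only on a null set, and there are countably many
  coordinates.\<close>

lemma AE_likelihood_pos: "AE x in table. \<forall>h<H. \<forall>a<K. p i a (x (h, a)) > 0"
proof -
  have "AE x in table. p i a (x (h, a)) > 0" if "h < H" "a < K" for h a
  proof -
    note [measurable_cong] = sets_\<nu>[OF that(2)]
    have "AE y in law (h, a). p i a y > 0"
      unfolding law_def reward_dist_def using that i_less by (auto simp: AE_density)
    then show ?thesis
      unfolding table_def using that prob_space_law by (intro AE_PiM_component) auto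
  qed
  then show ?thesis
    by (auto simp: AE_all_countable AE_ball_countable' intro!: AE_I2)
qed

lemma prob_eliminated:
  assumes "m * n \<le> H"
  shows "{x \<in> space table. i \<notin> cands x m} \<in> sets table"
    and "measure table {x \<in> space table. i \<notin> cands x m} \<le> real m * (1 - lam\<^sup>2 / 8) ^ n"
proof -
  let ?S = "{x \<in> space table. i \<notin> cands x m}"
  have "(\<lambda>x. cands x m) \<in> measurable table (count_space (Pow {..<M}))"
    unfolding table_def using assms by (intro cands_measurable) auto
  then have "(\<lambda>x. cands x m) -` {D \<in> Pow {..<M}. i \<notin> D} \<inter> space table \<in> sets table"
    by (rule measurable_sets) auto
  also have "(\<lambda>x. cands x m) -` {D \<in> Pow {..<M}. i \<notin> D} \<inter> space table = ?S"
    using cands_subset by auto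
  finally show S: "?S \<in> sets table" .
  have le: "Suc k * n \<le> H" if "k < m" for k
    using that assms by (meson Suc_leI le_trans mult_le_mono1)
  \<comment> \<open>Markov's inequality and the union bound over rounds in one estimate: the round
    in which \<open>i\<close> disappears contributes at least 1 to the sum.\<close>
  have "AE x in table. indicator ?S x \<le> (\<Sum>k<m. evidence k (cands x k) x)"
    using AE_likelihood_pos
  proof eventually_elim
    case (elim x)
    show ?case
    proof (cases "x \<in> ?S")
      case True
      then have "i \<notin> cands x m" "i \<in> cands x 0"
        using i_less by auto
      then obtain k where k: "k < m" "i \<in> cands x k" "i \<notin> cands x (Suc k)"
        by (induction m) (auto split: if_splits simp del: cands.simps intro: less_SucI)
      have "1 \<le> evidence k (cands x k) x"
        using k elim le[OF k(1)] by (intro evidence_ge_1) auto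
      also have "\<dots> \<le> (\<Sum>k<m. evidence k (cands x k) x)"
        using k by (intro member_le_sum) auto
      finally show ?thesis
        using True by simp
    qed simp
  qed
  then have "(\<integral>\<^sup>+x. indicator ?S x \<partial>table) \<le> (\<integral>\<^sup>+x. (\<Sum>k<m. evidence k (cands x k) x) \<partial>table)"
    by (rule nn_integral_mono_AE)
  then have "emeasure table ?S \<le> (\<integral>\<^sup>+x. (\<Sum>k<m. evidence k (cands x k) x) \<partial>table)"
    by (subst (asm) nn_integral_indicator[OF S])
  also have "\<dots> = (\<Sum>k<m. \<integral>\<^sup>+x. evidence k (cands x k) x \<partial>table)"
    unfolding table_def by (intro nn_integral_sum evidence_cands_measurable) (auto dest!: le)
  also have "\<dots> \<le> (\<Sum>k<m. ennreal (1 - lam\<^sup>2 / 8) ^ n)"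
    using le by (intro sum_mono nn_integral_evidence) auto
  also have "\<dots> = of_nat m * ennreal (1 - lam\<^sup>2 / 8) ^ n"
    by simp
  finally have "emeasure table ?S \<le> of_nat m * ennreal (1 - lam\<^sup>2 / 8) ^ n" .
  \<comment> \<open>Needed to return to real numbers, since \<open>ennreal\<close> maps negative
    numbers to 0.\<close>
  moreover have "0 \<le> 1 - lam\<^sup>2 / 8"
    using lam power_le_one[of lam 2] by simp
  ultimately have "ennreal (measure table ?S) \<le> ennreal (real m * (1 - lam\<^sup>2 / 8) ^ n)"
    by (simp add: table.emeasure_eq_measure ennreal_mult' ennreal_power ennreal_of_nat_eq_real_of_nat)
  with \<open>0 \<le> 1 - lam\<^sup>2 / 8\<close> show "measure table ?S \<le> real m * (1 - lam\<^sup>2 / 8) ^ n"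
    by (subst (asm) ennreal_le_iff) auto
qed

section \<open>From elimination to regret\<close>

lemma gap_bounds:
  assumes "a < K"
  shows "Max (mean_reward (reward_dist \<nu> p i) ` {..<K}) - mean_reward (reward_dist \<nu> p i) a \<in> {0..1}"
proof -
  have "Max (mean_reward (reward_dist \<nu> p i) ` {..<K}) \<in> mean_reward (reward_dist \<nu> p i) ` {..<K}"
    using assms by (intro Max_in) auto
  moreover have "mean_reward (reward_dist \<nu> p i) b \<in> {0..1}" if "b < K" for b
    using family i_less that by (auto simp: bandit_family_def)
  ultimately have "Max (mean_reward (reward_dist \<nu> p i) ` {..<K}) \<le> 1"
    by auto
  moreover have "mean_reward (reward_dist \<nu> p i) a \<le> Max (mean_reward (reward_dist \<nu> p i) ` {..<K})"
    using assms by (intro Max_ge) auto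
  moreover have "0 \<le> mean_reward (reward_dist \<nu> p i) a"
    using family i_less assms by (auto simp: bandit_family_def)
  ultimately show ?thesis
    by auto
qed

lemma opt_less: "j < M \<Longrightarrow> opt j < K"
  using choices by (auto simp: itc_choices_def is_arg_max_linorder)

lemma gap_opt:
  "Max (mean_reward (reward_dist \<nu> p i) ` {..<K}) = mean_reward (reward_dist \<nu> p i) (opt i)"
  using choices i_less
  by (intro Max_eqI) (auto simp: itc_choices_def is_arg_max_linorder)

lemma the_elem_cands_less: "\<not> card (cands x k) > 1 \<Longrightarrow> the_elem (cands x k) < M"
  and the_elem_cands_eq: "\<not> card (cands x k) > 1 \<Longrightarrow> i \<in> cands x k \<Longrightarrow> the_elem (cands x k) = i"
proof -
  assume "\<not> card (cands x k) > 1"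
  with card_cands[of x k] i_less have "card (cands x k) = 1"
    by simp
  then obtain j where j: "cands x k = {j}"
    by (auto simp: card_1_singleton_iff)
  with cands_subset[of x k] show "the_elem (cands x k) < M"
    by simp
  from j show "i \<in> cands x k \<Longrightarrow> the_elem (cands x k) = i"
    by simp
qed

lemma act_less: "act (history act x h) < K"
  using test_action_less[OF cands_subset, of x "h div n"] the_elem_cands_less[of x "h div n"] opt_less
  by (auto simp: act_history Let_def)

abbreviation gap :: "nat \<Rightarrow> real" where
  "gap a \<equiv> Max (mean_reward (reward_dist \<nu> p i) ` {..<K}) - mean_reward (reward_dist \<nu> p i) a"

text \<open>Each testing step costs at most 1. From step \<open>(M - 1) * n\<close> on, the agent
  plays \<open>opt i\<close> without loss if \<open>i\<close> survived, and loses at most 1 per step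
  otherwise.\<close>

lemma regret_le:
  "(\<Sum>h<H. gap (act (history act x h))) \<le>
     real ((M - 1) * n) + real H * indicator {x. i \<notin> cands x (M - 1)} x"
proof -
  have "gap (act (history act x h)) \<le>
      (if h < (M - 1) * n then 1 else 0) + indicator {x. i \<notin> cands x (M - 1)} x" for h
  proof (cases "h < (M - 1) * n \<or> i \<notin> cands x (M - 1)")
    case True
    then show ?thesis
      using gap_bounds[OF act_less[of x h]] by (auto simp: indicator_def)
  next
    case False
    then have "M - 1 \<le> h div n"
      using n_pos by (simp add: less_eq_div_iff_mult_less_eq)
    then have "cands x (h div n) = cands x (M - 1)"
      using i_less by (intro cands_stable) auto
    moreover have "\<not> card (cands x (M - 1)) > 1"
      using i_less by (simp add: card_cands)
    ultimately have "act (history act x h) = opt i"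
      using False the_elem_cands_eq[of x "M - 1"] by (simp add: act_history)
    then show ?thesis
      using False by (simp add: gap_opt)
  qed
  then have "(\<Sum>h<H. gap (act (history act x h))) \<le>
      (\<Sum>h<H. (if h < (M - 1) * n then 1 else 0) + indicator {x. i \<notin> cands x (M - 1)} x)"
    by (rule sum_mono)
  also have "\<dots> = real (card ({..<H} \<inter> {..<(M - 1) * n})) +
      real H * indicator {x. i \<notin> cands x (M - 1)} x"
    by (simp add: sum.distrib sum.If_cases lessThan_def)
  also have "card ({..<H} \<inter> {..<(M - 1) * n}) \<le> (M - 1) * n"
    using card_mono[of "{..<(M - 1) * n}" "{..<H} \<inter> {..<(M - 1) * n}"] by simp
  finally show ?thesis
    by simp
qed

text \<open>If all rounds fit into the horizon, the elimination bound applies to the pathwise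
  estimate. Otherwise \<open>H < (M - 1) * n\<close>, and the trivial bound \<open>H\<close> is
  already small enough.\<close>

lemma expected_regret_le:
  "(\<integral>x. (\<Sum>h<H. gap (act (history act x h))) \<partial>table) \<le>
     real ((M - 1) * n) + real H * (real (M - 1) * (1 - lam\<^sup>2 / 8) ^ n)"
proof (cases "(M - 1) * n \<le> H")
  case True
  let ?S = "{x \<in> space table. i \<notin> cands x (M - 1)}"
  note S = prob_eliminated[OF True]
  have int: "integrable table (\<lambda>x. real H * indicator ?S x)"
    using S(1) by (intro integrable_mult_right integrable_real_indicator)
      (auto simp: table.emeasure_eq_measure)
  have "(\<integral>x. (\<Sum>h<H. gap (act (history act x h))) \<partial>table) \<le>
      (\<integral>x. real ((M - 1) * n) + real H * indicator ?S x \<partial>table)"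
  \<comment> \<open>Integrability is checked for the nonnegative dominating function; an integral
    that does not exist has the value 0.\<close>
  proof (rule integral_mono')
    show "integrable table (\<lambda>x. real ((M - 1) * n) + real H * indicator ?S x)"
      using int by (intro Bochner_Integration.integrable_add) auto
    fix x assume "x \<in> space table"
    then show "(\<Sum>h<H. gap (act (history act x h))) \<le> real ((M - 1) * n) + real H * indicator ?S x"
      using regret_le[of x] by (simp add: indicator_def)
  qed simp
  also have "\<dots> = real ((M - 1) * n) + real H * measure table ?S"
    using int S(1) table.prob_space by (subst Bochner_Integration.integral_add) auto
  also have "\<dots> \<le> real ((M - 1) * n) + real H * (real (M - 1) * (1 - lam\<^sup>2 / 8) ^ n)"
    using S(2) by (intro add_left_mono mult_left_mono) auto
  finally show ?thesis .
next
  case False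
  have "(\<integral>x. (\<Sum>h<H. gap (act (history act x h))) \<partial>table) \<le> (\<integral>x. real H \<partial>table)"
  proof (rule integral_mono')
    fix x
    have "(\<Sum>h<H. gap (act (history act x h))) \<le> (\<Sum>h<H. 1)"
      using gap_bounds[OF act_less] by (intro sum_mono) auto
    then show "(\<Sum>h<H. gap (act (history act x h))) \<le> real H"
      by simp
  qed auto
  also have "\<dots> = real H"
    using table.prob_space by simp
  also have "\<dots> \<le> real ((M - 1) * n)"
    using False by linarith
  also have "\<dots> \<le> real ((M - 1) * n) + real H * (real (M - 1) * (1 - lam\<^sup>2 / 8) ^ n)"
    using lam power_le_one[of lam 2] by simp
  finally show ?thesis .
qed

end

section \<open>Averaging over the draws and constants\<close>

lemma set_pmf_itc_draws:
  assumes "u \<in> set_pmf (itc_draws M)" "D \<subseteq> {..<M}" "card D > 1"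
  shows "fst (u D) \<in> D \<and> snd (u D) \<in> D \<and> fst (u D) \<noteq> snd (u D)"
proof -
  let ?P = "{(i, j). i \<in> D \<and> j \<in> D \<and> i \<noteq> j}"
  have "finite {D. D \<subseteq> {..<M} \<and> card D > 1}"
    by (rule finite_subset[of _ "Pow {..<M}"]) auto
  with assms have "u D \<in> set_pmf (pmf_of_set ?P)"
    by (auto simp: itc_draws_def set_Pi_pmf PiE_dflt_def)
  moreover have "finite D"
    using assms(2) by (rule finite_subset) simp
  then have "finite ?P"
    by (intro finite_subset[of ?P "D \<times> D"]) auto
  \<comment> \<open>The support of \<open>pmf_of_set\<close> is the given set only if that set is
    finite and nonempty.\<close>
  moreover have "?P \<noteq> {}"
  proof -
    obtain i j where "i \<in> D" "j \<in> D" "i \<noteq> j"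
      using assms(3) card_le_Suc0_iff_eq[OF \<open>finite D\<close>] by auto
    then show ?thesis
      by auto
  qed
  ultimately have "u D \<in> ?P"
    by (simp add: set_pmf_of_set)
  then show ?thesis
    by (auto simp: case_prod_beta)
qed

lemma test_regret_itc_le:
  assumes "bandit_family M K \<nu> p" "0 < lam" "lam \<le> 1" "separated M K \<nu> p lam"
    and "itc_choices M K \<nu> p sel opt" "i < M" "n > 0"
  shows "test_regret K H (reward_dist \<nu> p i) (identify_then_commit M p n sel opt)
    \<le> real ((M - 1) * n) + real H * (real (M - 1) * (1 - lam\<^sup>2 / 8) ^ n)" (is "_ \<le> ?B")
proof -
  have "0 \<le> 1 - lam\<^sup>2 / 8"
    using assms(2,3) power_le_one[of lam 2] by simp
  then have B: "0 \<le> ?B"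
    by simp
  define R where "R u = (\<integral>x. (\<Sum>h<H. Max (mean_reward (reward_dist \<nu> p i) ` {..<K})
      - mean_reward (reward_dist \<nu> p i)
          (itc_action M p n sel opt u (history (itc_action M p n sel opt u) x h)))
      \<partial>PiM ({..<H} \<times> {..<K}) (\<lambda>(h, a). reward_dist \<nu> p i a))" for u
  have R: "R u \<le> ?B" if "u \<in> set_pmf (itc_draws M)" for u
  proof -
    interpret itc_bandit M n p sel opt u K H i \<nu> lam
      using assms set_pmf_itc_draws[OF that] by unfold_locales auto
    show ?thesis
      using expected_regret_le unfolding table_eq R_def .
  qed
  \<comment> \<open>The bound \<open>?B\<close> is the same for every draw in the support, so it
    survives averaging.\<close>
  have "(\<integral>u. R u \<partial>measure_pmf (itc_draws M)) \<le> (\<integral>u. ?B \<partial>measure_pmf (itc_draws M))"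
    using R B by (intro integral_mono_AE') (auto simp: AE_measure_pmf_iff)
  then show ?thesis
    by (simp add: test_regret_def identify_then_commit_def R_def)
qed

text \<open>As \<open>n\<close> is at least \<open>2 * L' / l ^ 4\<close>, the exponent
  \<open>n * l\<^sup>2 / 8\<close> is at least \<open>L' / (4 * l\<^sup>2)\<close>, hence at least
  \<open>L'\<close>. An error in one round then has probability at most
  \<open>1 / (2 * M * H)\<close>.\<close>

lemma regret_bound_numeric:
  fixes M H :: nat and lam :: real
  assumes M: "M \<ge> 2" and H: "H \<ge> 1" and lam: "0 < lam" "lam \<le> 2"
  defines "l \<equiv> min lam (1 / 2)"
  defines "n \<equiv> itc_samples M H l"
  shows "real ((M - 1) * n) + real H * (real (M - 1) * (1 - l\<^sup>2 / 8) ^ n)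
    \<le> 1088 * (real M * ln (real M * real H) / lam ^ 4)"
proof -
  define L L' where "L = ln (real M * real H)" and "L' = ln (2 * real M * real H)"
  have MH: "2 \<le> real M * real H"
    using mult_mono[of 2 "real M" 1 "real H"] M H by simp
  have l: "0 < l" "l \<le> 1 / 2" "lam / 4 \<le> l"
    using lam by (auto simp: l_def)
  have L: "1 / 2 \<le> L"
  proof -
    \<comment> \<open>From \<open>ln (1 / 2) <= - 1 / 2\<close>. This lower bound on
      \<open>L\<close> later absorbs additive constants.\<close>
    have "1 / 2 \<le> ln (2 :: real)"
      using ln_le_minus_one[of "1 / 2 :: real"] by (simp add: ln_div)
    also have "ln 2 \<le> L"
      unfolding L_def using MH by simp
    finally show ?thesis .
  qed
  have L': "L' = ln 2 + L" "0 \<le> L'" "L' \<le> 2 * L"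
  proof -
    show *: "L' = ln 2 + L"
      unfolding L'_def L_def using M H ln_mult[of 2 "real M * real H"]
      by (simp add: mult.assoc)
    have "ln 2 \<le> L"
      unfolding L_def using MH by simp
    with * show "L' \<le> 2 * L"
      by simp
    show "0 \<le> L'"
      using * L by simp
  qed
  have n_eq: "real n = of_int \<lceil>2 * L' / l ^ 4\<rceil>"
    unfolding n_def itc_samples_def L'_def[symmetric] using L'(2) l(1) by simp
  have n: "2 * L' / l ^ 4 \<le> real n" "real n \<le> 2 * L' / l ^ 4 + 1"
    unfolding n_eq by (rule le_of_int_ceiling, rule of_int_ceiling_le_add_one)
  have sq: "l\<^sup>2 \<le> 1 / 4"
    using power_mono[OF l(2), of 2] l(1) by (simp add: power2_eq_square)
  have "(1 - l\<^sup>2 / 8) ^ n \<le> exp (- (l\<^sup>2 / 8)) ^ n"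
    using exp_ge_add_one_self[of "- (l\<^sup>2 / 8)"] sq by (intro power_mono) auto
  also have "\<dots> = exp (- (real n * (l\<^sup>2 / 8)))"
    by (simp flip: exp_of_nat_mult)
  also have "\<dots> \<le> exp (- L')"
  proof -
    \<comment> \<open>The truncation of the separation at \<open>1 / 2\<close> enters here, as
      \<open>4 * l\<^sup>2 \<le> 1\<close>.\<close>
    have "L' \<le> L' / (4 * l\<^sup>2)"
      using L'(2) l(1) sq mult_left_mono[of "4 * l\<^sup>2" 1 L'] by (simp add: field_simps)
    also have "\<dots> = 2 * L' / l ^ 4 * (l\<^sup>2 / 8)"
      using l(1) by (simp add: field_simps power2_eq_square power4_eq_xxxx)
    also have "\<dots> \<le> real n * (l\<^sup>2 / 8)"
      using n(1) by (intro mult_right_mono) auto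
    finally show ?thesis
      by simp
  qed
  also have "exp (- L') = 1 / (2 * real M * real H)"
    unfolding L'_def using MH by (simp add: exp_minus field_simps)
  finally have "real H * (real (M - 1) * (1 - l\<^sup>2 / 8) ^ n) \<le>
      real H * (real M * (1 / (2 * real M * real H)))"
    using sq by (intro mult_left_mono mult_mono) auto
  also have "\<dots> \<le> 1"
    using M H by simp
  finally have "real ((M - 1) * n) + real H * (real (M - 1) * (1 - l\<^sup>2 / 8) ^ n)
      \<le> real (M * n) + 1"
    by (intro add_mono of_nat_mono mult_right_mono) auto
  also have "\<dots> \<le> real M * (real n + 1)"
    using M by (simp add: algebra_simps)
  \<comment> \<open>The main term uses \<open>L' <= 2 * L\<close> and \<open>lam / 4 <= l\<close>.
    The two units, one from rounding up and one from wrong commitments, are each at most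
    \<open>2 * L * (16 / lam ^ 4)\<close>. The constants add up to
    \<open>4 * 256 + 64 = 1088\<close>.\<close>
  also have "\<dots> \<le> real M * (2 * (2 * L) / (lam / 4) ^ 4 + 2 * (2 * L * (16 / lam ^ 4)))"
  proof (intro mult_left_mono)
    have "2 * L' / l ^ 4 \<le> 2 * (2 * L) / (lam / 4) ^ 4"
      using L L' l lam by (intro frac_le power_mono) auto
    moreover have "lam ^ 4 \<le> 16"
      using power_mono[OF lam(2), of 4] lam(1) by simp
    then have "1 * 1 \<le> 2 * L * (16 / lam ^ 4)"
      using L lam(1) by (intro mult_mono) auto
    ultimately show "real n + 1 \<le> 2 * (2 * L) / (lam / 4) ^ 4 + 2 * (2 * L * (16 / lam ^ 4))"
      using n(2) by linarith
  qed simp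
  also have "\<dots> = 1088 * (real M * L / lam ^ 4)"
    using lam(1) by (simp add: field_simps)
  finally show ?thesis
    by (simp only: L_def)
qed

theorem theoremC2:
  shows "\<exists>C::real. C > 0 \<and>
    (\<forall>(M::nat) (K::nat) (H::nat) (\<nu> :: nat \<Rightarrow> real measure) (p :: nat \<Rightarrow> nat \<Rightarrow> real \<Rightarrow> real)
      (lam::real) (sel :: nat \<Rightarrow> nat \<Rightarrow> nat) (opt :: nat \<Rightarrow> nat) (i::nat).
      bandit_family M K \<nu> p \<longrightarrow> lam > 0 \<longrightarrow> separated M K \<nu> p lam \<longrightarrow>
      itc_choices M K \<nu> p sel opt \<longrightarrow> H \<ge> M - 1 \<longrightarrow> i < M \<longrightarrow>
      test_regret K H (reward_dist \<nu> p i)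
        (identify_then_commit M p (itc_samples M H (min lam (1/2))) sel opt)
      \<le> C * (real M * ln (real M * real H) / lam ^ 4))"
proof (intro exI[of _ 1088] conjI allI impI)
  fix M K H :: nat and \<nu> :: "nat \<Rightarrow> real measure" and p :: "nat \<Rightarrow> nat \<Rightarrow> real \<Rightarrow> real"
    and lam :: real and sel :: "nat \<Rightarrow> nat \<Rightarrow> nat" and opt :: "nat \<Rightarrow> nat" and i :: nat
  assume family: "bandit_family M K \<nu> p" and lam: "lam > 0" and sep: "separated M K \<nu> p lam"
    and choices: "itc_choices M K \<nu> p sel opt" and H: "H \<ge> M - 1" and i: "i < M"
  define l n where "l = min lam (1 / 2)" and "n = itc_samples M H l"
  have sep': "separated M K \<nu> p l"
    using sep by (fastforce simp: separated_def l_def min_le_iff_disj)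
  show "test_regret K H (reward_dist \<nu> p i)
      (identify_then_commit M p (itc_samples M H (min lam (1/2))) sel opt)
    \<le> 1088 * (real M * ln (real M * real H) / lam ^ 4)"
  \<comment> \<open>For \<open>H = 0\<close> both sides are 0: the sum is empty and
    \<open>ln 0 = 0\<close>.\<close>
  proof (cases "H = 0")
    case True
    then show ?thesis
      by (simp add: test_regret_def)
  next
    case False
    with i have "1 \<le> real M * real H"
      by (simp flip: of_nat_mult)
    then have "0 < ln (2 * real M * real H)"
      by (intro ln_gt_zero) linarith
    moreover have "0 < l"
      using lam by (simp add: l_def)
    ultimately have "0 < 2 * ln (2 * real M * real H) / l ^ 4"
      by (intro divide_pos_pos mult_pos_pos) auto
    \<comment> \<open>Rounds must have positive length, since the policy divides the elapsed time by
      \<open>n\<close>.\<close>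
    then have "n > 0"
      by (simp add: n_def itc_samples_def)
    then have regret: "test_regret K H (reward_dist \<nu> p i) (identify_then_commit M p n sel opt)
        \<le> real ((M - 1) * n) + real H * (real (M - 1) * (1 - l\<^sup>2 / 8) ^ n)"
      using family lam sep' choices i by (intro test_regret_itc_le) (auto simp: l_def)
    show ?thesis
    \<comment> \<open>A single bandit makes separation vacuous, so \<open>lam\<close> may be
      arbitrarily large and the logarithm may be 0; but then there are no tests and the regret is at
      most 0.\<close>
    proof (cases "M = 1")
      case True
      then have "test_regret K H (reward_dist \<nu> p i) (identify_then_commit M p n sel opt) \<le> 0"
        using regret by simp
      also have "0 \<le> 1088 * (real M * ln (real M * real H) / lam ^ 4)"
        using \<open>1 \<le> real M * real H\<close> lam
        by (intro mult_nonneg_nonneg divide_nonneg_pos ln_ge_zero zero_less_power) auto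
      finally show ?thesis
        unfolding n_def l_def .
    next
      case False
      with i have M: "M \<ge> 2"
        by simp
      then have "\<exists>a<K. lam \<le> l1_dist \<nu> p 0 1 a"
        using sep by (simp add: separated_def)
      then obtain a where "a < K" "lam \<le> l1_dist \<nu> p 0 1 a"
        by blast
      then have "lam \<le> 2"
        using l1_dist_le_2[OF family, of 0 1 a] M by simp
      then have "real ((M - 1) * n) + real H * (real (M - 1) * (1 - l\<^sup>2 / 8) ^ n)
          \<le> 1088 * (real M * ln (real M * real H) / lam ^ 4)"
        unfolding n_def l_def using M \<open>H \<noteq> 0\<close> lam by (intro regret_bound_numeric) auto
      with regret show ?thesis
        unfolding n_def l_def by (rule order.trans)
    qed
  qed
qed simp

end
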